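(* For each $n \geq 5$, $\text{ex}(n,I_0)=n(n-2)$, and for each $n \geq 6$ there are exactly $(n-1)^n$ different labeled $I_0$-free $(2\to1)$-graphs (i.e. on the fixed vertex set $\{1,\dots,n\}$) that attain this maximum number of edges.
   Context: A $(2\to 1)$-graph (directed hypergraph) is a pair $H=(V,E)$ with $V$ a finite set and $E$ a set of pointed $3$-subsets of $V$: an edge, written $ab\to c$ (same as $ba\to c$), consists of three distinct vertices with head $c$ and tail set $\{a,b\}$. A $3$-subset of $V$ may carry up to three edges. $H$ is $F$-free if there is no injective map $\phi:V(F)\to V(H)$ such that $ab\to c\in E(F)$ implies $\phi(a)\phi(b)\to\phi(c)\in E(H)$. $\text{ex}(n,F)$ is the maximum number of edges of an $F$-free $(2\to1)$-graph on $n$ vertices. $I_0$ is the $(2\to1)$-graph with vertex set $\{a,b,c,d,x\}$ (five distinct vertices) and edges $ab\to x$, $cd\to x$. *)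

theory Defs
  imports Main
begin

text \<open>The edge \<open>ab \<rightarrow> c\<close> is the pair of its tail set \<open>{a, b}\<close> and its head \<open>c\<close>,
  so that \<open>ab \<rightarrow> c\<close> and \<open>ba \<rightarrow> c\<close> are the same edge.\<close>

type_synonym 'a edge = "'a set \<times> 'a"

definition arrow :: "'a \<Rightarrow> 'a \<Rightarrow> 'a \<Rightarrow> 'a edge" where
  "arrow a b c = ({a, b}, c)"

type_synonym 'a dihypergraph = "'a set \<times> 'a edge set"

abbreviation verts :: "'a dihypergraph \<Rightarrow> 'a set" where
  "verts H \<equiv> fst H"

abbreviation edges :: "'a dihypergraph \<Rightarrow> 'a edge set" where
  "edges H \<equiv> snd H"

definition two_one_graph :: "'a dihypergraph \<Rightarrow> bool" where
  "two_one_graph H \<longleftrightarrow> finite (verts H) \<and>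
     (\<forall>(T, h) \<in> edges H. T \<subseteq> verts H \<and> card T = 2 \<and> h \<in> verts H \<and> h \<notin> T)"

definition free_of :: "'b dihypergraph \<Rightarrow> 'a dihypergraph \<Rightarrow> bool" where
  "free_of F H \<longleftrightarrow>
     \<not> (\<exists>\<phi>. inj_on \<phi> (verts F) \<and> \<phi> ` verts F \<subseteq> verts H \<and>
          (\<forall>a b c. arrow a b c \<in> edges F \<longrightarrow> arrow (\<phi> a) (\<phi> b) (\<phi> c) \<in> edges H))"

text \<open>Every graph on \<open>n\<close> vertices is isomorphic to one whose vertices are natural numbers,
  so it suffices to take the maximum over the latter. The set of values
  is finite, and it contains \<open>0\<close> (the edgeless graph) whenever \<open>F\<close> has an edge, so that
  \<open>Max\<close> is a genuine maximum in that case.\<close>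

definition ex :: "nat \<Rightarrow> 'b dihypergraph \<Rightarrow> nat" where
  "ex n F = Max {card (edges H) | H :: nat dihypergraph.
     two_one_graph H \<and> card (verts H) = n \<and> free_of F H}"

datatype I0_vertex = Va | Vb | Vc | Vd | Vx

definition I0 :: "I0_vertex dihypergraph" where
  "I0 = ({Va, Vb, Vc, Vd, Vx}, {arrow Va Vb Vx, arrow Vc Vd Vx})"

definition extremal_labeled :: "nat \<Rightarrow> 'b dihypergraph \<Rightarrow> nat dihypergraph set" where
  "extremal_labeled n F = {H. two_one_graph H \<and> verts H = {1..n} \<and> free_of F H \<and>
     card (edges H) = ex n F}"

end

theory Submission
  imports Defs "HOL-Library.FuncSet"
begin

text \<open>Being \<open>I\<^sub>0\<close>-free means that, for each head \<open>x\<close>, the tail sets of the edges pointing to \<open>x\<close>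
  form an intersecting family of pairs in the remaining \<open>n - 1\<close> vertices: a star, with at most
  \<open>n - 2\<close> members, or a subset of a triangle, with at most \<open>3\<close>. The heads are independent of
  each other. For \<open>n \<ge> 5\<close> stars are optimal; for \<open>n \<ge> 6\<close> only full stars are, and each
  of the \<open>n\<close> heads admits \<open>n - 1\<close> star centres.\<close>

section \<open>Stars of pairs\<close>

definition pair_star :: "'a set \<Rightarrow> 'a \<Rightarrow> 'a set set" where
  "pair_star W c = (\<lambda>y. {c, y}) ` (W - {c})"

lemma card_pair_star:
  assumes "c \<in> W"
  shows "card (pair_star W c) = card W - 1"
proof -
  have "inj_on (\<lambda>y. {c, y}) (W - {c})"
    by (auto simp: inj_on_def doubleton_eq_iff)
  then show ?thesis
    using assms unfolding pair_star_def by (simp add: card_image card_Diff_singleton)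
qed

lemma mem_pair_star_iff:
  assumes "c \<in> W"
  shows "T \<in> pair_star W c \<longleftrightarrow> T \<subseteq> W \<and> card T = 2 \<and> c \<in> T"
proof
  assume "T \<in> pair_star W c"
  then show "T \<subseteq> W \<and> card T = 2 \<and> c \<in> T"
    using assms by (auto simp: pair_star_def)
next
  assume T: "T \<subseteq> W \<and> card T = 2 \<and> c \<in> T"
  then obtain a b where "T = {a, b}" "a \<noteq> b"
    by (meson card_2_iff)
  with T show "T \<in> pair_star W c"
    by (auto simp: pair_star_def insert_commute)
qed

text \<open>A third point \<open>y\<close> gives a pair \<open>{c, y}\<close> that the star at
  \<open>d\<close> cannot contain. On two points both stars would consist of the same single
  pair.\<close>

lemma pair_star_inj:
  assumes "card W \<ge> 3" "c \<in> W" "pair_star W c = pair_star W d"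
  shows "c = d"
proof (rule ccontr)
  assume "c \<noteq> d"
  have "card {c, d} < card W"
    using assms(1) \<open>c \<noteq> d\<close> by simp
  then have "\<not> W \<subseteq> {c, d}"
    by (metis card_mono finite.emptyI finite.insertI leD)
  then obtain y where y: "y \<in> W" "y \<noteq> c" "y \<noteq> d"
    by blast
  then have "{c, y} \<in> pair_star W d"
    using assms(3) by (auto simp: pair_star_def)
  with y \<open>c \<noteq> d\<close> show False
    by (auto simp: pair_star_def doubleton_eq_iff)
qed

section \<open>Intersecting families of pairs\<close>

lemma card_2_eq_pair:
  assumes "card T = 2" "x \<in> T" "y \<in> T" "x \<noteq> y"
  shows "T = {x, y}"
proof -
  obtain u v where "T = {u, v}"
    using assms(1) by (meson card_2_iff)
  with assms(2-4) show ?thesis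
    by auto
qed

text \<open>A pair \<open>{a, b}\<close>, a member avoiding \<open>a\<close> and a member avoiding
  \<open>b\<close> must form a triangle. A pair that meets all three sides of a triangle is itself a
  side.\<close>

lemma card_intersecting_pairs_not_star:
  assumes pairs: "\<And>T. T \<in> F \<Longrightarrow> card T = 2"
    and meet: "\<And>S T. S \<in> F \<Longrightarrow> T \<in> F \<Longrightarrow> S \<inter> T \<noteq> {}"
    and nostar: "\<And>c. \<exists>T\<in>F. c \<notin> T"
  shows "card F \<le> 3"
proof -
  from nostar obtain P where P: "P \<in> F"
    by blast
  with pairs obtain a b where ab: "P = {a, b}" "a \<noteq> b"
    by (meson card_2_iff)
  from nostar obtain Q where Q: "Q \<in> F" "a \<notin> Q"
    by blast
  from nostar obtain R where R: "R \<in> F" "b \<notin> R"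
    by blast
  have "b \<in> Q"
    using meet[OF P Q(1)] ab(1) Q(2) by simp
  have "a \<in> R"
    using meet[OF P R(1)] ab(1) R(2) by simp
  \<comment> \<open>The third corner: it differs from \<open>a\<close> and \<open>b\<close> because
    \<open>Q\<close> avoids \<open>a\<close> and \<open>R\<close> avoids \<open>b\<close>.\<close>
  obtain c where c: "c \<in> Q" "c \<in> R"
    using meet[OF Q(1) R(1)] by blast
  have ne: "c \<noteq> a" "c \<noteq> b"
    using c Q(2) R(2) by blast+
  have Q_eq: "Q = {b, c}"
    by (rule card_2_eq_pair[OF pairs[OF Q(1)] \<open>b \<in> Q\<close> c(1)]) (use ne in simp)
  have R_eq: "R = {a, c}"
    by (rule card_2_eq_pair[OF pairs[OF R(1)] \<open>a \<in> R\<close> c(2)]) (use ne in simp)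
  have "T \<in> {{a, b}, {b, c}, {a, c}}" if T: "T \<in> F" for T
  proof -
    have "a \<in> T \<or> b \<in> T" "b \<in> T \<or> c \<in> T" "a \<in> T \<or> c \<in> T"
      using meet[OF P T] meet[OF Q(1) T] meet[OF R(1) T] unfolding ab(1) Q_eq R_eq by blast+
    then consider "a \<in> T" "b \<in> T" | "b \<in> T" "c \<in> T" | "a \<in> T" "c \<in> T"
      by blast
    then show ?thesis
      using card_2_eq_pair[OF pairs[OF T]] ab(2) ne by cases (metis insertCI)+
  qed
  then have "F \<subseteq> {{a, b}, {b, c}, {a, c}}"
    by blast
  then have "card F \<le> card {{a, b}, {b, c}, {a, c}}"
    by (intro card_mono) simp_all
  \<comment> \<open>The length of a list bounds the size of its set, so the three sides need not be
    shown distinct.\<close>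
  also have "\<dots> \<le> 3"
    using card_length[of "[{a, b}, {b, c}, {a, c}]"] by simp
  finally show ?thesis .
qed

lemma intersecting_pairs_star_or_small:
  assumes "F \<subseteq> Pow W" "W \<noteq> {}" "\<And>T. T \<in> F \<Longrightarrow> card T = 2"
    and "\<And>S T. S \<in> F \<Longrightarrow> T \<in> F \<Longrightarrow> S \<inter> T \<noteq> {}"
  obtains c where "c \<in> W" "F \<subseteq> pair_star W c" | "card F \<le> 3"
proof (cases "\<exists>c. \<forall>T\<in>F. c \<in> T")
  case True
  then obtain c where c: "\<forall>T\<in>F. c \<in> T"
    by blast
  show ?thesis
  \<comment> \<open>In the empty family every \<open>c\<close> is vacuously a common point, possibly
    outside \<open>W\<close>; this case goes to the second alternative.\<close>
  proof (cases "F = {}")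
    case True
    then show ?thesis
      using that(2) by simp
  next
    case False
    with c assms(1) have "c \<in> W"
      by blast
    moreover have "F \<subseteq> pair_star W c"
    proof
      fix T
      assume "T \<in> F"
      then show "T \<in> pair_star W c"
        unfolding mem_pair_star_iff[OF \<open>c \<in> W\<close>] using c assms(1,3) by simp blast
    qed
    ultimately show ?thesis
      by (rule that(1))
  qed
next
  case False
  then have "card F \<le> 3"
    by (intro card_intersecting_pairs_not_star assms(3,4)) auto
  then show ?thesis
    by (rule that(2))
qed

lemma finite_pair_star: "finite W \<Longrightarrow> finite (pair_star W c)"
  by (simp add: pair_star_def)

text \<open>Four points are what makes the triangle bound 3 at most the size of a star.\<close>

lemma card_intersecting_pairs_le:
  assumes "finite W" "card W \<ge> 4" "F \<subseteq> Pow W" "\<And>T. T \<in> F \<Longrightarrow> card T = 2"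
    and "\<And>S T. S \<in> F \<Longrightarrow> T \<in> F \<Longrightarrow> S \<inter> T \<noteq> {}"
  shows "card F \<le> card W - 1"
proof -
  have "W \<noteq> {}"
    using assms(2) by auto
  from assms(3) this assms(4,5) show ?thesis
  proof (rule intersecting_pairs_star_or_small)
    fix c
    assume "c \<in> W" "F \<subseteq> pair_star W c"
    then show ?thesis
      by (metis card_mono card_pair_star finite_pair_star assms(1))
  qed (use assms(2) in auto)
qed

text \<open>With five points a star has at least four members, so a triangle is too small, and a
  subfamily of a star with the size of the star is all of it. On four points a triangle would tie
  with a star.\<close>

lemma card_intersecting_pairs_eq:
  assumes "finite W" "card W \<ge> 5" "F \<subseteq> Pow W" "\<And>T. T \<in> F \<Longrightarrow> card T = 2"
    and "\<And>S T. S \<in> F \<Longrightarrow> T \<in> F \<Longrightarrow> S \<inter> T \<noteq> {}"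
    and "card F = card W - 1"
  shows "\<exists>c\<in>W. F = pair_star W c"
proof -
  have "W \<noteq> {}"
    using assms(2) by auto
  from assms(3) this assms(4,5) show ?thesis
  proof (rule intersecting_pairs_star_or_small)
    fix c
    assume "c \<in> W" "F \<subseteq> pair_star W c"
    then show ?thesis
      by (metis card_subset_eq card_pair_star finite_pair_star assms(1,6))
  qed (use assms(2,6) in auto)
qed

section \<open>Links of heads and freeness from \<open>I0\<close>\<close>

definition link :: "'a dihypergraph \<Rightarrow> 'a \<Rightarrow> 'a set set" where
  "link H x = {T. (T, x) \<in> edges H}"

lemma two_one_graph_finite: "two_one_graph H \<Longrightarrow> finite (verts H)"
  unfolding two_one_graph_def by (rule conjunct1)

lemma two_one_graph_link:
  assumes "two_one_graph H" "T \<in> link H x"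
  shows "T \<subseteq> verts H - {x}" "card T = 2" "x \<in> verts H"
proof -
  have "(T, x) \<in> edges H"
    using assms(2) by (simp add: link_def)
  from bspec[OF conjunct2[OF assms(1)[unfolded two_one_graph_def]] this]
  have "T \<subseteq> verts H \<and> card T = 2 \<and> x \<in> verts H \<and> x \<notin> T"
    by simp
  then show "T \<subseteq> verts H - {x}" "card T = 2" "x \<in> verts H"
    by blast+
qed

text \<open>A copy of \<open>I0\<close> is the same as two disjoint tails with a common head, so
  freeness splits into one condition per head.\<close>

lemma free_of_I0_iff:
  assumes H: "two_one_graph H"
  shows "free_of I0 H \<longleftrightarrow> (\<forall>x. \<forall>S\<in>link H x. \<forall>T\<in>link H x. S \<inter> T \<noteq> {})"
proof
  assume free: "free_of I0 H"
  show "\<forall>x. \<forall>S\<in>link H x. \<forall>T\<in>link H x. S \<inter> T \<noteq> {}"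
  proof (intro allI ballI notI)
    fix x S T
    assume S: "S \<in> link H x" and T: "T \<in> link H x" and disj: "S \<inter> T = {}"
    obtain p q where pq: "S = {p, q}" "p \<noteq> q"
      using two_one_graph_link(2)[OF H S] by (meson card_2_iff)
    obtain r s where rs: "T = {r, s}" "r \<noteq> s"
      using two_one_graph_link(2)[OF H T] by (meson card_2_iff)
    \<comment> \<open>Injective because the two tails are disjoint pairs and neither contains
      \<open>x\<close>.\<close>
    define \<phi> where "\<phi> v = (case v of Va \<Rightarrow> p | Vb \<Rightarrow> q | Vc \<Rightarrow> r | Vd \<Rightarrow> s | Vx \<Rightarrow> x)" for v
    have "inj_on \<phi> (verts I0)" "\<phi> ` verts I0 \<subseteq> verts H"
      using two_one_graph_link(1,3)[OF H S] two_one_graph_link(1)[OF H T] pq(2) rs(2) disj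
      unfolding pq(1) rs(1) by (auto simp: I0_def \<phi>_def)
    \<comment> \<open>An edge determines only its tail set, so \<open>a\<close> and \<open>b\<close>
      may come in either order.\<close>
    moreover have "arrow (\<phi> a) (\<phi> b) (\<phi> c) \<in> edges H" if "arrow a b c \<in> edges I0" for a b c
      using that S T unfolding pq(1) rs(1)
      by (auto simp: I0_def arrow_def link_def \<phi>_def doubleton_eq_iff insert_commute)
    ultimately show False
      using free unfolding free_of_def by blast
  qed
next
  assume meet: "\<forall>x. \<forall>S\<in>link H x. \<forall>T\<in>link H x. S \<inter> T \<noteq> {}"
  show "free_of I0 H"
    unfolding free_of_def
  proof (intro notI, elim exE conjE)
    fix \<phi>
    assume inj: "inj_on \<phi> (verts I0)"
      and edge: "\<forall>a b c. arrow a b c \<in> edges I0 \<longrightarrow> arrow (\<phi> a) (\<phi> b) (\<phi> c) \<in> edges H"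
    have "{\<phi> Va, \<phi> Vb} \<in> link H (\<phi> Vx)" "{\<phi> Vc, \<phi> Vd} \<in> link H (\<phi> Vx)"
      using edge by (auto simp: I0_def link_def arrow_def)
    then have "{\<phi> Va, \<phi> Vb} \<inter> {\<phi> Vc, \<phi> Vd} \<noteq> {}"
      using meet by blast
    with inj show False
      by (auto simp: I0_def)
  qed
qed

text \<open>An edge stores its tail first, whereas \<open>Sigma\<close> puts the index, here the
  head, first; hence the swap.\<close>

lemma edges_eq_Sigma_link:
  assumes "two_one_graph H"
  shows "edges H = prod.swap ` Sigma (verts H) (link H)"
  using two_one_graph_link(3)[OF assms] by (force simp: link_def)

lemma card_edges_eq_sum_link:
  assumes H: "two_one_graph H"
  shows "card (edges H) = (\<Sum>x\<in>verts H. card (link H x))"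
proof -
  have fin: "finite (verts H)"
    by (rule two_one_graph_finite[OF H])
  have "link H x \<subseteq> Pow (verts H)" for x
    using two_one_graph_link(1)[OF H] by blast
  then have "finite (link H x)" for x
    using fin by (meson finite_Pow_iff finite_subset)
  then have "card (Sigma (verts H) (link H)) = (\<Sum>x\<in>verts H. card (link H x))"
    using fin by (intro card_SigmaI) simp_all
  then show ?thesis
    unfolding edges_eq_Sigma_link[OF H] by (simp add: card_image)
qed

text \<open>The head removes one vertex and the centre of a star another, whence the 2. At least
  four vertices remain for the tails, as the bound on intersecting pairs requires.\<close>

lemma card_link_le:
  assumes H: "two_one_graph H" and free: "free_of I0 H" and card: "card (verts H) \<ge> 5"
    and x: "x \<in> verts H"
  shows "card (link H x) \<le> card (verts H) - 2"
proof -
  have "card (link H x) \<le> card (verts H - {x}) - 1"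
  proof (rule card_intersecting_pairs_le)
    show "finite (verts H - {x})"
      using two_one_graph_finite[OF H] by simp
    show "4 \<le> card (verts H - {x})"
      using card x by (simp add: card_Diff_singleton)
    show "link H x \<subseteq> Pow (verts H - {x})"
      using two_one_graph_link(1)[OF H] by blast
    show "card T = 2" if "T \<in> link H x" for T
      using H that by (rule two_one_graph_link(2))
    show "S \<inter> T \<noteq> {}" if "S \<in> link H x" "T \<in> link H x" for S T
      using free that unfolding free_of_I0_iff[OF H] by blast
  qed
  then show ?thesis
    using x by (simp add: card_Diff_singleton)
qed

section \<open>Star graphs and the extremal number\<close>

definition star_graph :: "'a set \<Rightarrow> ('a \<Rightarrow> 'a) \<Rightarrow> 'a dihypergraph" where
  "star_graph V f = (V, {(T, x). x \<in> V \<and> T \<in> pair_star (V - {x}) (f x)})"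

text \<open>Any two tails with head \<open>x\<close> share the centre \<open>f x\<close>. Taking
  \<open>f\<close> extensional makes it determined by its values on \<open>V\<close>, which the
  final count relies on.\<close>

lemma star_graph_props:
  assumes V: "finite V" and f: "f \<in> (\<Pi>\<^sub>E x\<in>V. V - {x})"
  shows "two_one_graph (star_graph V f)" "free_of I0 (star_graph V f)"
    "card (edges (star_graph V f)) = card V * (card V - 2)"
proof -
  have mem: "f x \<in> V - {x}" if "x \<in> V" for x
    using f that by (rule PiE_mem)
  have link: "link (star_graph V f) x = (if x \<in> V then pair_star (V - {x}) (f x) else {})" for x
    by (auto simp: link_def star_graph_def)
  show graph: "two_one_graph (star_graph V f)"
    using V mem mem_pair_star_iff[OF mem] by (auto simp: two_one_graph_def star_graph_def)
  show "free_of I0 (star_graph V f)"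
    unfolding free_of_I0_iff[OF graph] link using mem_pair_star_iff[OF mem] by auto
  have "card (edges (star_graph V f)) = (\<Sum>x\<in>V. card V - 2)"
    unfolding card_edges_eq_sum_link[OF graph] link
    by (rule sum.cong) (use card_pair_star[OF mem] in \<open>auto simp: star_graph_def card_Diff_singleton\<close>)
  then show "card (edges (star_graph V f)) = card V * (card V - 2)"
    by simp
qed

lemma card_edges_I0_free_le:
  assumes H: "two_one_graph H" and "free_of I0 H" "card (verts H) \<ge> 5"
  shows "card (edges H) \<le> card (verts H) * (card (verts H) - 2)"
  unfolding card_edges_eq_sum_link[OF H]
  using sum_bounded_above[of "verts H" "\<lambda>x. card (link H x)"] card_link_le[OF assms] by fastforce

lemma ex_I0:
  assumes n: "n \<ge> 5"
  shows "ex n I0 = n * (n - 2)"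
  unfolding ex_def
proof (rule Max_eqI)
  let ?A = "{card (edges H) | H :: nat dihypergraph.
    two_one_graph H \<and> card (verts H) = n \<and> free_of I0 H}"
  show le: "y \<le> n * (n - 2)" if "y \<in> ?A" for y
  proof -
    from that obtain H :: "nat dihypergraph" where H: "two_one_graph H" "free_of I0 H"
      "card (verts H) = n" "y = card (edges H)"
      by blast
    with card_edges_I0_free_le[OF H(1,2)] n show ?thesis
      by simp
  qed
  \<comment> \<open>\<open>Max\<close> requires a finite set; the upper bound just shown supplies
    this.\<close>
  then show "finite ?A"
    unfolding finite_nat_set_iff_bounded_le by (intro exI ballI)
  \<comment> \<open>Any choice of centres distinct from their heads would do: here 1 for every head
    except 1 itself.\<close>
  define f where "f = (\<lambda>x\<in>{1..n}. if x = 1 then 2 else (1::nat))"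
  have f: "f \<in> (\<Pi>\<^sub>E x\<in>{1..n}. {1..n} - {x})"
    unfolding f_def by (rule restrict_PiE_iff[THEN iffD2]) (use n in simp)
  have "card (edges (star_graph {1..n} f)) = n * (n - 2)"
    using star_graph_props(3)[OF _ f] by simp
  moreover have "card (verts (star_graph {1..n} f)) = n"
    by (simp add: star_graph_def)
  ultimately show "n * (n - 2) \<in> ?A"
    using star_graph_props(1,2)[OF finite_atLeastAtMost f]
    by (intro CollectI exI[of _ "star_graph {1..n} f"]) simp
qed

section \<open>Classification and count of the extremal graphs\<close>

lemma extremal_I0_is_star_graph:
  assumes H: "two_one_graph H" and free: "free_of I0 H" and card: "card (verts H) \<ge> 6"
    and max: "card (edges H) = card (verts H) * (card (verts H) - 2)"
  shows "\<exists>f\<in>(\<Pi>\<^sub>E x\<in>verts H. verts H - {x}). H = star_graph (verts H) f"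
proof -
  let ?V = "verts H"
  have fin: "finite ?V"
    by (rule two_one_graph_finite[OF H])
  have le: "card (link H x) \<le> card ?V - 2" if "x \<in> ?V" for x
    using card_link_le[OF H free _ that] card by simp
  \<comment> \<open>One link below the bound would push the whole sum below the maximum, since no
    other link can compensate.\<close>
  have link_card: "card (link H x) = card ?V - 2" if "x \<in> ?V" for x
  proof (rule ccontr)
    assume "card (link H x) \<noteq> card ?V - 2"
    with le[OF that] have "card (link H x) < card ?V - 2"
      by simp
    with le that have "(\<Sum>y\<in>?V. card (link H y)) < (\<Sum>y\<in>?V. card ?V - 2)"
      by (intro sum_strict_mono_ex1 fin) auto
    with max show False
      by (simp add: card_edges_eq_sum_link[OF H])
  qed
  have "\<exists>c\<in>?V - {x}. link H x = pair_star (?V - {x}) c" if "x \<in> ?V" for x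
  proof (rule card_intersecting_pairs_eq)
    show "finite (?V - {x})"
      using fin by simp
    show "5 \<le> card (?V - {x})" "card (link H x) = card (?V - {x}) - 1"
      using card that link_card[OF that] by (simp_all add: card_Diff_singleton)
    show "link H x \<subseteq> Pow (?V - {x})"
      using two_one_graph_link(1)[OF H] by blast
    show "card T = 2" if "T \<in> link H x" for T
      using H that by (rule two_one_graph_link(2))
    show "S \<inter> T \<noteq> {}" if "S \<in> link H x" "T \<in> link H x" for S T
      using free that unfolding free_of_I0_iff[OF H] by blast
  qed
  then obtain g where g: "g x \<in> ?V - {x}" "link H x = pair_star (?V - {x}) (g x)"
    if "x \<in> ?V" for x
    by metis
  have "(T, x) \<in> edges H \<longleftrightarrow> x \<in> ?V \<and> T \<in> pair_star (?V - {x}) (g x)" for T x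
    using g(2)[of x] two_one_graph_link(3)[OF H, of T x] by (auto simp: link_def)
  \<comment> \<open>The star graph consults \<open>g\<close> on the vertices only, so restricting
    \<open>g\<close> makes it extensional without changing the graph.\<close>
  then have "H = star_graph ?V (restrict g ?V)"
    by (auto simp: star_graph_def prod_eq_iff)
  moreover have "restrict g ?V \<in> (\<Pi>\<^sub>E x\<in>?V. ?V - {x})"
    using g(1) by auto
  ultimately show ?thesis
    by blast
qed

text \<open>The link of each head recovers its centre, since at least three vertices remain beside
  the head; extensionality settles the values outside \<open>V\<close>.\<close>

lemma inj_on_star_graph:
  assumes "card V \<ge> 4"
  shows "inj_on (star_graph V) (\<Pi>\<^sub>E x\<in>V. V - {x})"
proof (rule inj_onI)
  fix f g
  assume f: "f \<in> (\<Pi>\<^sub>E x\<in>V. V - {x})" and g: "g \<in> (\<Pi>\<^sub>E x\<in>V. V - {x})"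
    and eq: "star_graph V f = star_graph V g"
  show "f = g"
  proof (rule PiE_ext[OF f g])
    fix x
    assume x: "x \<in> V"
    show "f x = g x"
    proof (rule pair_star_inj)
      show "card (V - {x}) \<ge> 3"
        using assms x by (simp add: card_Diff_singleton)
      show "f x \<in> V - {x}"
        using f x by (rule PiE_mem)
      show "pair_star (V - {x}) (f x) = pair_star (V - {x}) (g x)"
        using eq x by (auto simp: star_graph_def set_eq_iff)
    qed
  qed
qed

lemma extremal_labeled_I0:
  assumes n: "n \<ge> 6"
  shows "extremal_labeled n I0 = star_graph {1..n} ` (\<Pi>\<^sub>E x\<in>{1..n}. {1..n} - {x})"
proof (intro equalityI subsetI)
  have ex: "ex n I0 = n * (n - 2)"
    using n by (simp add: ex_I0)
  {
    fix H
    assume "H \<in> extremal_labeled n I0"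
    then have H: "two_one_graph H" "free_of I0 H" "verts H = {1..n}"
      "card (edges H) = n * (n - 2)"
      by (auto simp: extremal_labeled_def ex)
    with extremal_I0_is_star_graph[of H] n
    show "H \<in> star_graph {1..n} ` (\<Pi>\<^sub>E x\<in>{1..n}. {1..n} - {x})"
      by auto
  next
    fix H
    assume "H \<in> star_graph {1..n} ` (\<Pi>\<^sub>E x\<in>{1..n}. {1..n} - {x})"
    then obtain f where f: "f \<in> (\<Pi>\<^sub>E x\<in>{1..n}. {1..n} - {x})" "H = star_graph {1..n} f"
      by blast
    with star_graph_props[OF _ f(1)] show "H \<in> extremal_labeled n I0"
      by (auto simp: extremal_labeled_def ex star_graph_def)
  }
qed

text \<open>By injectivity it remains to count the choices of centres: \<open>n - 1\<close> for each
  of the \<open>n\<close> heads, independently.\<close>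

lemma card_extremal_labeled_I0:
  assumes n: "n \<ge> 6"
  shows "card (extremal_labeled n I0) = (n - 1) ^ n"
proof -
  have "card (extremal_labeled n I0) = card (\<Pi>\<^sub>E x\<in>{1..n}. {1..n} - {x})"
    unfolding extremal_labeled_I0[OF n] using n by (intro card_image inj_on_star_graph) simp
  also have "\<dots> = (\<Prod>x\<in>{1..n}. n - 1)"
    by (subst card_PiE) (auto simp: card_Diff_singleton intro!: prod.cong)
  finally show ?thesis
    by simp
qed

theorem theorem2p2:
  "(\<forall>n::nat. n \<ge> 5 \<longrightarrow> ex n I0 = n * (n - 2)) \<and>
   (\<forall>n::nat. n \<ge> 6 \<longrightarrow> card (extremal_labeled n I0) = (n - 1) ^ n)"
  using ex_I0 card_extremal_labeled_I0 by blast

end
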